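(* Let $n\ge2$, let $C_1,\dots,C_n\in\mathcal C$, let $\mathcal R_b\in\{\mathcal R,R_{\mathrm{FW}}\}$ be one of the two band constructions, and put $S_b=\bigcup_{1\le i<j\le n}\mathcal R_b(C_i,C_j)$. Then for every $C\in\mathcal C$, $$D^{(b)}_{\mathrm{int}}(C\mid\{C_i\})\le \mu_C(S_b).$$ Consequently, if a sequence $\{C^{(k)}\}\subset\mathcal C$ satisfies $\mu_{C^{(k)}}(S_b)\to0$, then $D^{(b)}_{\mathrm{int}}(C^{(k)}\mid\{C_i\})\to0$; moreover $D^{(b)}_{\mathrm{inf}}(C^{(k)}\mid\{C_i\})=0$ for all sufficiently large $k$.
   Context: Curve space. Let $\mathbb S^1=[0,1]/\{0\sim1\}$ and $I\in\{[0,1],\mathbb S^1\}$. $\mathcal F(I)$ is the set of continuous maps $f:I\to\mathbb R^2$ of finite length $L(f)=\sup\sum_j\|f(\tau_j)-f(\tau_{j-1})\|_2$ (supremum over partitions $0=\tau_0<\dots<\tau_J=1$) whose arc-length map $s_f(t)=L(f|_{[0,t]})$ is strictly increasing (for $I=\mathbb S^1$, $f$ is identified with a continuous map on $[0,1]$ with $f(0)=f(1)$). Write $f_1\sim f_2$ if $f_1=f_2\circ\phi$ for an orientation-preserving or orientation-reversing homeomorphism $\phi:I\to I$. The curve space is $\mathcal C=(\mathcal F([0,1])/\!\sim)\sqcup(\mathcal F(\mathbb S^1)/\!\sim)$; elements of the first part are called open, of the second part closed. For $C\in\mathcal C$, the length $L(C)=L(f)$ and the trace $\Gamma_C=f(I)$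 do not depend on the representative $f\in C$. Standing assumption: $L(C)>0$ for all curves considered. In set-theoretic expressions $C$ is identified with $\Gamma_C$. Arc-length representative and measure. An arc-length representative of $C$ is $\beta_C^{\mathrm{arc}}=f\circ s_f^{-1}$ on $[0,L(C)]$ (with $0\sim L(C)$ identified if $C$ is closed), for a representative $f$ of $C$; it is unique up to orientation reversal (open case), or up to circular shift and reversal (closed case). The arc-length probability measure is $\mu_C(B)=\frac1{L(C)}\int_0^{L(C)}\mathbf 1_B(\beta_C^{\mathrm{arc}}(s))\,ds$ for Borel $B\subseteq\mathbb R^2$; it depends only on $C$ and is assumed non-atomic. Global band: $\mathcal R(A,B)=\{(1-\lambda)x+\lambda y: x\in\Gamma_A,\ y\in\Gamma_B,\ \lambda\in[0,1]\}$. Fast-walk (FW) band. Put $\beta_C(t)=\beta_C^{\mathrm{arc}}(L(C)t)$ on $[0,1]$ or $\mathbb S^1$. If $C$ is open, $\mathcal G(C)=\{\beta_C,\beta_C^{\leftarrow}\}$ with $\beta_C^{\leftarrow}(t)=\beta_C(1-t)$. If $C$ is closed, $\mathcal G(C)=\{\beta_C^\theta,(\beta_C^\theta)^{\leftarrow}:\theta\in\mathbb S^1\}$ with $\beta_C^\theta(t)=\beta_C(t+\theta \bmod 1)$ and $(\beta_C^\theta)^{\leftarrow}(t)=\beta_C(\theta-t \bmod 1)$ (so each element has equal values at $0$ and $1$). For $\alpha\in\mathcal G(A)$, $\beta\in\mathcal G(B)$, let $\gamma_{\alpha,\beta}:\mathbb S^1\to\mathbb R^2$ be the closed loop obtained by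 concatenating $\alpha$ on $[0,1]$, the segment from $\alpha(1)$ to $\beta(1)$, $\beta$ traversed in reverse, and the segment from $\beta(0)$ to $\alpha(0)$ (each on a quarter of $\mathbb S^1$), and let $W(\alpha,\beta)$ be its image. For $p\notin W(\alpha,\beta)$ let $n_2(\gamma_{\alpha,\beta};p)\in\{0,1\}$ be the degree of $t\mapsto(\gamma_{\alpha,\beta}(t)-p)/\|\gamma_{\alpha,\beta}(t)-p\|$ reduced mod $2$. Set $E(\alpha,\beta)=W(\alpha,\beta)\cup\{p\notin W(\alpha,\beta): n_2(\gamma_{\alpha,\beta};p)=1\}$ and $\Delta(\alpha,\beta)=\|\alpha(1)-\beta(1)\|_2+\|\alpha(0)-\beta(0)\|_2$; let $\mathcal M(A,B)$ be the set of minimizers of $\Delta$ over $\mathcal G(A)\times\mathcal G(B)$. The FW band is $R_{\mathrm{FW}}(A,B)=\mathrm{cl}\bigl(\bigcup_{(\alpha,\beta)\in\mathcal M(A,B)}E(\alpha,\beta)\bigr)$. Depths. For a band $\mathcal R_b\in\{\mathcal R,R_{\mathrm{FW}}\}$: $D^{(b)}_{\mathrm{int}}(C\mid\{C_i\})=\binom n2^{-1}\sum_{1\le i<j\le n}\mu_C(\mathcal R_b(C_i,C_j))$ and $D^{(b)}_{\mathrm{inf}}(C\mid\{C_i\})=\binom n2^{-1}\sum_{1\le i<j\le n}\mathbf 1\{\mu_C(\mathcal R_b(C_i,C_j))=1\}$. *)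

theory Defs
  imports "HOL-Complex_Analysis.Complex_Analysis"
begin

type_synonym plane = "real ^ 2"

section \<open>Curve space\<close>

text \<open>
  A map on \<open>[0,1]\<close> is a total function \<open>real \<Rightarrow> plane\<close> whose values off \<open>[0,1]\<close> are ignored; a map on
  the circle is such a function with equal values at \<open>0\<close> and \<open>1\<close>.
\<close>

text \<open>
  Only strictly increasing partitions are used, so for \<open>a = b\<close> the one-point partition (\<open>J = 0\<close>)
  is the only one and the length is \<open>0\<close>.
\<close>

definition polygon_lengths :: "(real \<Rightarrow> plane) \<Rightarrow> real \<Rightarrow> real \<Rightarrow> real set" where
  "polygon_lengths f a b =
     {(\<Sum>j = 1..J. norm (f (\<tau> j) - f (\<tau> (j - 1)))) | J (\<tau> :: nat \<Rightarrow> real).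
        \<tau> 0 = a \<and> \<tau> J = b \<and> strict_mono_on {0..J} \<tau>}"

definition length_on :: "(real \<Rightarrow> plane) \<Rightarrow> real \<Rightarrow> real \<Rightarrow> real" where
  "length_on f a b = Sup (polygon_lengths f a b)"

definition arc_length_map :: "(real \<Rightarrow> plane) \<Rightarrow> real \<Rightarrow> real" where
  "arc_length_map f t = length_on f 0 t"

definition open_maps :: "(real \<Rightarrow> plane) set" where
  "open_maps = {f. continuous_on {0..1} f \<and> bdd_above (polygon_lengths f 0 1) \<and>
                   strict_mono_on {0..1} (arc_length_map f)}"

definition closed_maps :: "(real \<Rightarrow> plane) set" where
  "closed_maps = {f \<in> open_maps. f 0 = f 1}"

text \<open>
  Every homeomorphism of \<open>[0,1]\<close> or of the circle either preserves or reverses orientation, so both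
  relations range over all homeomorphisms. For closed maps the circle \<open>[0,1]/{0 ~ 1}\<close> is realised
  as the unit circle in the complex plane, \<open>t\<close> corresponding to \<open>cis (2 * pi * t)\<close>.
\<close>

definition open_rel :: "((real \<Rightarrow> plane) \<times> (real \<Rightarrow> plane)) set" where
  "open_rel = {(f1, f2). f1 \<in> open_maps \<and> f2 \<in> open_maps \<and>
     (\<exists>\<phi> \<psi>. homeomorphism {0..1} {0..1} \<phi> \<psi> \<and> (\<forall>t\<in>{0..1}. f1 t = f2 (\<phi> t)))}"

definition closed_rel :: "((real \<Rightarrow> plane) \<times> (real \<Rightarrow> plane)) set" where
  "closed_rel = {(f1, f2). f1 \<in> closed_maps \<and> f2 \<in> closed_maps \<and>
     (\<exists>\<phi> \<psi>. homeomorphism (sphere (0::complex) 1) (sphere 0 1) \<phi> \<psi> \<and>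
        (\<forall>s\<in>{0..1}. \<forall>t\<in>{0..1}. \<phi> (cis (2 * pi * s)) = cis (2 * pi * t) \<longrightarrow> f1 s = f2 t))}"

type_synonym curve = "(real \<Rightarrow> plane) set + (real \<Rightarrow> plane) set"

text \<open>Left summands are the open curves, right summands the closed ones.\<close>

definition curve_space :: "curve set" where
  "curve_space = (open_maps // open_rel) <+> (closed_maps // closed_rel)"

text \<open>
  All objects below are defined from an arbitrarily chosen representative; those attached to a
  curve (length, trace, measure, set of parametrizations restricted to \<open>[0,1]\<close>) do not depend on
  the choice.
\<close>

definition curve_rep :: "curve \<Rightarrow> real \<Rightarrow> plane" where
  "curve_rep C = (case C of Inl X \<Rightarrow> (SOME f. f \<in> X) | Inr X \<Rightarrow> (SOME f. f \<in> X))"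

definition curve_length :: "curve \<Rightarrow> real" where
  "curve_length C = length_on (curve_rep C) 0 1"

definition curve_trace :: "curve \<Rightarrow> plane set" where
  "curve_trace C = curve_rep C ` {0..1}"

section \<open>Arc-length representative and measure\<close>

definition arc_rep :: "curve \<Rightarrow> real \<Rightarrow> plane" where
  "arc_rep C s = curve_rep C (the_inv_into {0..1} (arc_length_map (curve_rep C)) s)"

definition arc_measure :: "curve \<Rightarrow> plane set \<Rightarrow> real" where
  "arc_measure C B =
     1 / curve_length C * (LBINT s:{0..curve_length C}. indicator B (arc_rep C s))"

definition nonatomic :: "(plane set \<Rightarrow> real) \<Rightarrow> bool" where
  "nonatomic \<mu> \<longleftrightarrow>
     (\<forall>A\<in>sets borel. \<mu> A > 0 \<longrightarrow> (\<exists>B\<in>sets borel. B \<subseteq> A \<and> 0 < \<mu> B \<and> \<mu> B < \<mu> A))"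

text \<open>The curves under consideration, i.e. those meeting the standing assumptions.\<close>

definition admissible :: "curve \<Rightarrow> bool" where
  "admissible C \<longleftrightarrow> C \<in> curve_space \<and> curve_length C > 0 \<and> nonatomic (arc_measure C)"

section \<open>Global band\<close>

definition global_band :: "curve \<Rightarrow> curve \<Rightarrow> plane set" where
  "global_band A B =
     {(1 - l) *\<^sub>R x + l *\<^sub>R y | x y l. x \<in> curve_trace A \<and> y \<in> curve_trace B \<and> l \<in> {0..1}}"

section \<open>Fast-walk band\<close>

definition unit_rep :: "curve \<Rightarrow> real \<Rightarrow> plane" where
  "unit_rep C t = arc_rep C (curve_length C * t)"

definition parametrizations :: "curve \<Rightarrow> (real \<Rightarrow> plane) set" where
  "parametrizations C =
     (case C of
        Inl _ \<Rightarrow> {unit_rep C, (\<lambda>t. unit_rep C (1 - t))}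
      | Inr _ \<Rightarrow> (\<Union>\<theta>\<in>{0..<1}. {(\<lambda>t. unit_rep C (frac (t + \<theta>))),
                                 (\<lambda>t. unit_rep C (frac (\<theta> - t)))}))"

text \<open>The bracketing gives each of the four pieces a quarter of the parameter interval.\<close>

definition fw_loop :: "(real \<Rightarrow> plane) \<Rightarrow> (real \<Rightarrow> plane) \<Rightarrow> real \<Rightarrow> plane" where
  "fw_loop \<alpha> \<beta> =
     (\<alpha> +++ linepath (\<alpha> 1) (\<beta> 1)) +++ (reversepath \<beta> +++ linepath (\<beta> 0) (\<alpha> 0))"

definition to_complex :: "plane \<Rightarrow> complex" where
  "to_complex x = Complex (x $ 1) (x $ 2)"

text \<open>
  The degree of a loop in the unit circle is its winding number about the origin. The library's
  winding number is complex-valued, hence the conversion to an integer.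
\<close>

definition circle_degree :: "(real \<Rightarrow> plane) \<Rightarrow> int" where
  "circle_degree u = (THE d. of_int d = winding_number (to_complex \<circ> u) 0)"

definition mod2_degree :: "(real \<Rightarrow> plane) \<Rightarrow> plane \<Rightarrow> int" where
  "mod2_degree \<gamma> p = circle_degree (\<lambda>t. (\<gamma> t - p) /\<^sub>R norm (\<gamma> t - p)) mod 2"

definition fw_region :: "(real \<Rightarrow> plane) \<Rightarrow> (real \<Rightarrow> plane) \<Rightarrow> plane set" where
  "fw_region \<alpha> \<beta> =
     path_image (fw_loop \<alpha> \<beta>) \<union>
     {p. p \<notin> path_image (fw_loop \<alpha> \<beta>) \<and> mod2_degree (fw_loop \<alpha> \<beta>) p = 1}"

definition endpoint_gap :: "(real \<Rightarrow> plane) \<Rightarrow> (real \<Rightarrow> plane) \<Rightarrow> real" where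
  "endpoint_gap \<alpha> \<beta> = norm (\<alpha> 1 - \<beta> 1) + norm (\<alpha> 0 - \<beta> 0)"

definition fw_minimizers :: "curve \<Rightarrow> curve \<Rightarrow> ((real \<Rightarrow> plane) \<times> (real \<Rightarrow> plane)) set" where
  "fw_minimizers A B =
     {q. is_arg_min (\<lambda>(\<alpha>, \<beta>). endpoint_gap \<alpha> \<beta>)
           (\<lambda>q. q \<in> parametrizations A \<times> parametrizations B) q}"

definition fw_band :: "curve \<Rightarrow> curve \<Rightarrow> plane set" where
  "fw_band A B = closure (\<Union>(\<alpha>, \<beta>)\<in>fw_minimizers A B. fw_region \<alpha> \<beta>)"

section \<open>Depths\<close>

definition index_pairs :: "nat \<Rightarrow> (nat \<times> nat) set" where
  "index_pairs n = {(i, j). 1 \<le> i \<and> i < j \<and> j \<le> n}"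

definition int_depth ::
  "(curve \<Rightarrow> curve \<Rightarrow> plane set) \<Rightarrow> nat \<Rightarrow> (nat \<Rightarrow> curve) \<Rightarrow> curve \<Rightarrow> real" where
  "int_depth R n Cs C =
     1 / real (n choose 2) * (\<Sum>(i, j)\<in>index_pairs n. arc_measure C (R (Cs i) (Cs j)))"

definition inf_depth ::
  "(curve \<Rightarrow> curve \<Rightarrow> plane set) \<Rightarrow> nat \<Rightarrow> (nat \<Rightarrow> curve) \<Rightarrow> curve \<Rightarrow> real" where
  "inf_depth R n Cs C =
     1 / real (n choose 2) *
     (\<Sum>(i, j)\<in>index_pairs n. if arc_measure C (R (Cs i) (Cs j)) = 1 then 1 else 0)"

definition band_union ::
  "(curve \<Rightarrow> curve \<Rightarrow> plane set) \<Rightarrow> nat \<Rightarrow> (nat \<Rightarrow> curve) \<Rightarrow> plane set" where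
  "band_union R n Cs = (\<Union>(i, j)\<in>index_pairs n. R (Cs i) (Cs j))"

end

theory Submission
  imports Defs
begin

text \<open>
  Both bands are closed, so the arc-length measure is monotone on the inclusion of each band in the
  union of all bands; averaging over the pairs gives the bound, and the two limit claims follow.
  The only analytic point is the measurability of the arc-length representative, for which
  monotonicity of the arc-length map suffices.
\<close>

text \<open>Freezing \<open>s\<close> at its endpoint values outside \<open>{a..b}\<close> gives a
  monotone function on the whole line, the form that \<open>borel_measurable_mono\<close>
  expects.\<close>

lemma mono_clamp:
  fixes s :: "real \<Rightarrow> real"
  assumes "strict_mono_on {a..b} s" "a \<le> b"
  shows "mono (\<lambda>t. s (max a (min b t)))"
  using assms by (intro monoI strict_mono_on_leD[OF assms(1)]) auto

text \<open>
  No continuity of \<open>s\<close> is needed: with the monotone left inverse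
  \<open>g u = Sup {t. s t \<le> u}\<close>, the range of \<open>s\<close> is the Borel set \<open>{u. s (g u) = u}\<close>. Off that range
  \<open>the_inv_into\<close> is a constant junk value, possibly outside \<open>{a..b}\<close>.
\<close>

lemma borel_measurable_comp_the_inv_into:
  fixes f :: "real \<Rightarrow> 'a::euclidean_space" and s :: "real \<Rightarrow> real"
  assumes f: "continuous_on {a..b} f" and s: "strict_mono_on {a..b} s" and ab: "a \<le> b"
  shows "(\<lambda>u. f (the_inv_into {a..b} s u)) \<in> borel_measurable borel"
proof -
  define c where "c = (\<lambda>t. max a (min b t))"
  \<comment> \<open>Inserting \<open>a\<close> keeps the set nonempty when \<open>u\<close> lies
    below \<open>s a\<close>, so the supremum is meaningful and monotone in
    \<open>u\<close>.\<close>
  define A where "A = (\<lambda>u. insert a {t \<in> {a..b}. s t \<le> u})"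
  define g where "g = (\<lambda>u. Sup (A u))"
  have c_in: "c t \<in> {a..b}" for t
    using ab by (auto simp: c_def)
  have c_id: "c t = t" if "t \<in> {a..b}" for t
    using that by (auto simp: c_def)
  have A_sub: "A u \<subseteq> {a..b}" for u
    using ab by (auto simp: A_def)
  then have bdd: "bdd_above (A u)" for u
    by (meson bdd_above_Icc bdd_above_mono)
  have "mono g"
    unfolding g_def by (intro monoI cSup_subset_mono bdd) (auto simp: A_def)
  have g_in: "g u \<in> {a..b}" for u
  proof -
    have "a \<le> g u"
      unfolding g_def by (intro cSup_upper bdd) (simp add: A_def)
    moreover have "g u \<le> b"
      unfolding g_def using A_sub[of u] by (intro cSup_least) (auto simp: A_def)
    ultimately show ?thesis by simp
  qed
  have inj: "inj_on s {a..b}"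
    using s by (rule strict_mono_on_imp_inj_on)
  have g_s: "g (s t) = t" if t: "t \<in> {a..b}" for t
  proof -
    have "s x \<le> s t \<longleftrightarrow> x \<le> t" if "x \<in> {a..b}" for x
      using strict_mono_onD[OF s t that] strict_mono_on_leD[OF s that t] by linarith
    then have "A (s t) = {a..t}"
      using t by (auto simp: A_def)
    then show ?thesis using t by (simp add: g_def)
  qed
  have [measurable]: "g \<in> borel_measurable borel" "(\<lambda>t. s (c t)) \<in> borel_measurable borel"
    using \<open>mono g\<close> mono_clamp[OF s ab] by (auto intro: borel_measurable_mono simp: c_def)
  have "continuous_on UNIV (\<lambda>t. f (c t))"
    using c_in by (intro continuous_on_compose2[OF f]) (auto simp: c_def intro!: continuous_intros)
  then have [measurable]: "(\<lambda>t. f (c t)) \<in> borel_measurable borel"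
    by (rule borel_measurable_continuous_onI)
  have "(\<lambda>u. f (the_inv_into {a..b} s u)) =
        (\<lambda>u. if s (c (g u)) = u then f (c (g u)) else f (THE y. False))"
  proof
    fix u
    show "f (the_inv_into {a..b} s u) =
        (if s (c (g u)) = u then f (c (g u)) else f (THE y. False))"
    proof (cases "s (c (g u)) = u")
      case True
      then show ?thesis
        using the_inv_into_f_f[OF inj c_in[of "g u"]] by simp
    next
      case False
      \<comment> \<open>A preimage \<open>y\<close> of \<open>u\<close> would give
        \<open>g u = y\<close> and hence \<open>s (c (g u)) = u\<close>. Equality of the whole
        predicates makes the two \<open>THE\<close> terms coincide.\<close>
      then have "(\<lambda>y. y \<in> {a..b} \<and> s y = u) = (\<lambda>y. False)"
        using g_s c_id by auto
      then have "the_inv_into {a..b} s u = (THE y. False)"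
        unfolding the_inv_into_def by (rule arg_cong)
      with False show ?thesis by simp
    qed
  qed
  also have "\<dots> \<in> borel_measurable borel"
    by measurable
  finally show ?thesis .
qed

lemma open_rel_refl: "f \<in> open_maps \<Longrightarrow> (f, f) \<in> open_rel"
  unfolding open_rel_def using homeomorphism_ident by fastforce

text \<open>The identity of the circle is a witness once \<open>f\<close> agrees at any two
  parameters naming the same circle point; in the unit interval only 0 and 1 are identified.\<close>

lemma closed_rel_refl:
  assumes "f \<in> closed_maps"
  shows "(f, f) \<in> closed_rel"
proof -
  have "f s = f t"
    if st: "s \<in> {0..1}" "t \<in> {0..1}" and eq: "cis (2 * pi * s) = cis (2 * pi * t)" for s t
  proof -
    have "sin (2 * pi * s) = sin (2 * pi * t) \<and> cos (2 * pi * s) = cos (2 * pi * t)"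
      using eq by (simp add: complex_eq_iff)
    then obtain m :: int where "2 * pi * s = 2 * pi * t + 2 * pi * m"
      by (auto simp: sin_cos_eq_iff)
    then have "2 * pi * s = 2 * pi * (t + m)"
      by (simp add: algebra_simps)
    then have s: "s = t + m"
      by simp
    \<comment> \<open>Two points of the unit interval differ by at most 1, and by exactly 1 only at
      the endpoints.\<close>
    then have "-1 \<le> m" "m \<le> 1"
      using st by auto
    then consider "m = -1" | "m = 0" | "m = 1"
      by linarith
    then have "s = t \<or> s = 0 \<and> t = 1 \<or> s = 1 \<and> t = 0"
      using s st by cases auto
    then show ?thesis
      using assms by (auto simp: closed_maps_def)
  qed
  then have "homeomorphism (sphere (0::complex) 1) (sphere 0 1) (\<lambda>x. x) (\<lambda>x. x) \<and>
      (\<forall>s\<in>{0..1}. \<forall>t\<in>{0..1}. cis (2 * pi * s) = cis (2 * pi * t) \<longrightarrow> f s = f t)"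
    using homeomorphism_ident by blast
  then show ?thesis
    unfolding closed_rel_def using assms by blast
qed

text \<open>Reflexivity makes each class nonempty, so \<open>SOME\<close> picks a genuine member,
  and both relations relate only maps in \<open>open_maps\<close>.\<close>

lemma curve_rep_in_open_maps:
  assumes "C \<in> curve_space"
  shows "curve_rep C \<in> open_maps"
proof (cases C)
  case (Inl X)
  then obtain f where f: "f \<in> open_maps" and X: "X = open_rel `` {f}"
    using assms by (auto simp: curve_space_def quotient_def)
  have "(SOME g. g \<in> X) \<in> X"
    using open_rel_refl[OF f] X by (metis ImageI insertI1 someI)
  then have "curve_rep C \<in> open_rel `` {f}"
    by (simp only: curve_rep_def Inl sum.case X)
  then show ?thesis
    by (simp add: open_rel_def)
next
  case (Inr X)
  then obtain f where f: "f \<in> closed_maps" and X: "X = closed_rel `` {f}"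
    using assms by (auto simp: curve_space_def quotient_def)
  have "(SOME g. g \<in> X) \<in> X"
    using closed_rel_refl[OF f] X by (metis ImageI insertI1 someI)
  then have "curve_rep C \<in> closed_rel `` {f}"
    by (simp only: curve_rep_def Inr sum.case X)
  then show ?thesis
    by (simp add: closed_rel_def closed_maps_def)
qed

lemma borel_measurable_arc_rep:
  assumes "C \<in> curve_space"
  shows "arc_rep C \<in> borel_measurable borel"
  using curve_rep_in_open_maps[OF assms]
    borel_measurable_comp_the_inv_into[of 0 1 "curve_rep C" "arc_length_map (curve_rep C)"]
  by (simp add: open_maps_def arc_rep_def[abs_def])

lemma arc_measure_nonneg: "curve_length C > 0 \<Longrightarrow> 0 \<le> arc_measure C B"
  by (auto simp: arc_measure_def set_lebesgue_integral_def intro!: mult_nonneg_nonneg integral_nonneg)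

text \<open>The integrand for \<open>S\<close> is measurable and dominated by the indicator of a
  bounded interval, hence integrable.\<close>

lemma arc_measure_mono:
  assumes "C \<in> curve_space" "curve_length C > 0" "S \<in> sets borel" "B \<subseteq> S"
  shows "arc_measure C B \<le> arc_measure C S"
proof -
  note [measurable] = borel_measurable_arc_rep[OF assms(1)] assms(3)
  have "integrable lborel (indicator {0..curve_length C} :: real \<Rightarrow> real)"
    by (intro integrable_real_indicator) (auto simp: emeasure_lborel_Icc_eq)
  then have "integrable lborel (\<lambda>s. indicator {0..curve_length C} s *\<^sub>R (indicator S (arc_rep C s) :: real))"
    by (rule Bochner_Integration.integrable_bound) (measurable, auto simp: indicator_def)
  then have "(LBINT s:{0..curve_length C}. indicator B (arc_rep C s)) \<le>
      (LBINT s:{0..curve_length C}. (indicator S (arc_rep C s) :: real))"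
    \<comment> \<open>If the integrand for \<open>B\<close> is not integrable, its integral has the
      default value 0, still below the nonnegative integral for \<open>S\<close>.\<close>
    unfolding set_lebesgue_integral_def
    using assms(4) by (intro integral_mono') (auto simp: indicator_def)
  then show ?thesis
    using assms(2) by (simp add: arc_measure_def divide_right_mono)
qed

text \<open>The band is the image of the compact set of triples \<open>(x, y, l)\<close> under a
  continuous map.\<close>

lemma closed_global_band:
  assumes "A \<in> curve_space" "B \<in> curve_space"
  shows "closed (global_band A B)"
proof -
  have compact: "compact (curve_trace C)" if "C \<in> curve_space" for C
    unfolding curve_trace_def using curve_rep_in_open_maps[OF that]
    by (intro compact_continuous_image) (auto simp: open_maps_def)
  have "global_band A B =
      (\<lambda>p. (1 - snd (snd p)) *\<^sub>R fst p + snd (snd p) *\<^sub>R fst (snd p)) `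
        (curve_trace A \<times> curve_trace B \<times> {0..1})"
    by (simp add: global_band_def set_eq_iff image_iff Bex_def split_paired_Ex) metis
  also have "compact \<dots>"
  proof (rule compact_continuous_image)
    show "compact (curve_trace A \<times> curve_trace B \<times> {0..1::real})"
      by (intro compact_Times compact assms compact_Icc)
  qed (intro continuous_intros)
  finally show ?thesis
    by (rule compact_imp_closed)
qed

lemma finite_index_pairs: "finite (index_pairs n)"
  by (rule finite_subset[of _ "{1..n} \<times> {1..n}"]) (auto simp: index_pairs_def)

text \<open>Passing to \<open>Suc n\<close> adds the \<open>n\<close> pairs whose larger index is
  \<open>Suc n\<close>, which matches Pascal's rule.\<close>

lemma card_index_pairs: "card (index_pairs n) = n choose 2"
proof (induction n)
  case 0
  have "index_pairs 0 = {}" by (auto simp: index_pairs_def)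
  then show ?case by simp
next
  case (Suc n)
  have "index_pairs (Suc n) = index_pairs n \<union> {1..n} \<times> {Suc n}"
    by (auto simp: index_pairs_def)
  moreover have "index_pairs n \<inter> {1..n} \<times> {Suc n} = {}"
    by (auto simp: index_pairs_def)
  ultimately have "card (index_pairs (Suc n)) = card (index_pairs n) + n"
    by (simp add: card_Un_disjoint finite_index_pairs card_cartesian_product)
  then show ?case
    using Suc by (simp add: numeral_2_eq_2)
qed

theorem proposition4p2:
  fixes n :: nat and Cs :: "nat \<Rightarrow> curve" and R :: "curve \<Rightarrow> curve \<Rightarrow> plane set"
  assumes "n \<ge> 2"
    and "\<And>i. i \<in> {1..n} \<Longrightarrow> admissible (Cs i)"
    and "R \<in> {global_band, fw_band}"
  shows "(\<forall>C. admissible C \<longrightarrow> int_depth R n Cs C \<le> arc_measure C (band_union R n Cs)) \<and>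
         (\<forall>K :: nat \<Rightarrow> curve.
            (\<forall>k. admissible (K k)) \<longrightarrow>
            (\<lambda>k. arc_measure (K k) (band_union R n Cs)) \<longlonglongrightarrow> 0 \<longrightarrow>
            (\<lambda>k. int_depth R n Cs (K k)) \<longlonglongrightarrow> 0 \<and>
            (\<forall>\<^sub>F k in sequentially. inf_depth R n Cs (K k) = 0))"
proof -
  let ?S = "band_union R n Cs"
  have "closed (R (Cs i) (Cs j))" if "(i, j) \<in> index_pairs n" for i j
  proof -
    have "Cs i \<in> curve_space" "Cs j \<in> curve_space"
      using that assms(2)[of i] assms(2)[of j] by (auto simp: index_pairs_def admissible_def)
    \<comment> \<open>The fast-walk band is closed because it is defined as a closure.\<close>
    then show ?thesis
      using assms(3) closed_global_band by (auto simp: fw_band_def)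
  qed
  then have "closed ?S"
    unfolding band_union_def using finite_index_pairs by (intro closed_UN) auto
  then have S: "?S \<in> sets borel"
    by (rule borel_closed)
  have le: "arc_measure C (R (Cs i) (Cs j)) \<le> arc_measure C ?S"
    if "admissible C" "(i, j) \<in> index_pairs n" for C i j
    using that S by (intro arc_measure_mono) (auto simp: admissible_def band_union_def)
  have pos: "real (n choose 2) > 0"
    using assms(1) by simp
  have bound: "int_depth R n Cs C \<le> arc_measure C ?S" if C: "admissible C" for C
  proof -
    \<comment> \<open>Each summand is at most the mass of the union, and the number of summands
      cancels the normalising factor.\<close>
    have "(\<Sum>(i, j)\<in>index_pairs n. arc_measure C (R (Cs i) (Cs j))) \<le>
        (\<Sum>_\<in>index_pairs n. arc_measure C ?S)"
      using le[OF C] by (intro sum_mono) auto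
    also have "\<dots> = real (n choose 2) * arc_measure C ?S"
      by (simp add: card_index_pairs)
    finally show ?thesis
      using pos by (simp add: int_depth_def divide_le_eq mult.commute)
  qed
  have nonneg: "0 \<le> int_depth R n Cs C" if "admissible C" for C
    using that by (auto simp: int_depth_def admissible_def intro!: divide_nonneg_nonneg sum_nonneg arc_measure_nonneg)
  have "(\<lambda>k. int_depth R n Cs (K k)) \<longlonglongrightarrow> 0 \<and> (\<forall>\<^sub>F k in sequentially. inf_depth R n Cs (K k) = 0)"
    if K: "\<forall>k. admissible (K k)" and lim: "(\<lambda>k. arc_measure (K k) ?S) \<longlonglongrightarrow> 0" for K :: "nat \<Rightarrow> curve"
  proof
    show "(\<lambda>k. int_depth R n Cs (K k)) \<longlonglongrightarrow> 0"
      using K bound nonneg by (intro tendsto_sandwich[OF _ _ tendsto_const lim]) auto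
    \<comment> \<open>Once the union has mass below 1, no single band can have mass 1, so every
      indicator in the sum vanishes.\<close>
    have "\<forall>\<^sub>F k in sequentially. arc_measure (K k) ?S < 1"
      using order_tendstoD(2)[OF lim] by simp
    then show "\<forall>\<^sub>F k in sequentially. inf_depth R n Cs (K k) = 0"
    proof eventually_elim
      case (elim k)
      then have "arc_measure (K k) (R (Cs i) (Cs j)) \<noteq> 1" if "(i, j) \<in> index_pairs n" for i j
        using le[OF K[rule_format, of k] that] by linarith
      then show ?case
        by (auto simp: inf_depth_def intro!: sum.neutral)
    qed
  qed
  with bound show ?thesis by blast
qed

end
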